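(* Let $a,b,c,d$ be positive real numbers with $\min\{c,d\}>\max\{a,b\}$, let $n\in\mathbb{N}$, and let $Q_{n+1}(x;a,b;c,d)$ be the type I function for the index of length $n+1$ on the step line with respect to the weight vector $\overline{\mathcal{W}}(x;a,b;c,d)$. Then, for $x\in(0,1)$, $$Q_{n+1}(x;a,b;c,d)=\frac{(-1)^n}{n!}\,\frac{\mathrm{d}^n}{\mathrm{d}x^n}\left(\mathcal{W}\left(x;a+n,b+n;c+\left\lfloor\frac{n+1}{2}\right\rfloor+n,d+\left\lfloor\frac n2\right\rfloor+n\right)\right).$$
   Context: $\mathbb{N}=\{0,1,2,\dots\}$. For positive reals $a,b,c,d$ with $\delta:=c+d-a-b>0$, the function $\mathcal{W}(\cdot\,;a,b;c,d)$ on $(0,1)$ is defined by $$\mathcal{W}(x;a,b;c,d)=\frac{\Gamma(c)\Gamma(d)}{\Gamma(a)\Gamma(b)\Gamma(\delta)}\,x^{a-1}(1-x)^{\delta-1}\,{}_2F_1(c-b,d-b;\delta;1-x),$$ where ${}_2F_1(\alpha,\beta;\gamma;z)=\sum_{n\ge0}\frac{(\alpha)_n(\beta)_n}{(\gamma)_n}\frac{z^n}{n!}$ for $|z|<1$, with $(z)_n$ the Pochhammer symbol (rising factorial). (The condition $\min\{c,d\}>\max\{a,b\}$ implies $\delta>0$.) The weight vector $\overline{\mathcal{W}}(x;a,b;c,d)$ has components $w_0(x)=\mathcal{W}(x;a,b;c,d)$ and $w_1(x)=\mathcal{W}(x;a,b+1;c+1,d)$ on $(0,1)$. The index of length $n$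 on the step line is $(n_0,n_1)=(m,m)$ if $n=2m$ and $(n_0,n_1)=(m+1,m)$ if $n=2m+1$. For $n\ge1$, the type I function for this index is $Q_n(x;a,b;c,d)=A_n(x)w_0(x)+B_n(x)w_1(x)$, where $A_n,B_n$ are polynomials with $\deg A_n\le n_0-1$ and $\deg B_n\le n_1-1$ (degree $\le -1$ meaning the zero polynomial) such that $\int_0^1x^kQ_n(x)\,\mathrm{d}x=0$ for $0\le k\le n-2$ and $\int_0^1x^{n-1}Q_n(x)\,\mathrm{d}x=1$. For these weights and every $n\ge 1$ this object exists and is unique. *)

theory Defs
  imports "HOL-Analysis.Analysis" "HOL-Computational_Algebra.Polynomial"
begin

text \<open>The Gauss hypergeometric series; meaningful for \<open>\<bar>z\<bar> < 1\<close> and \<open>\<gamma>\<close> not a nonpositive integer.\<close>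

definition hyp2F1 :: "real \<Rightarrow> real \<Rightarrow> real \<Rightarrow> real \<Rightarrow> real" where
  "hyp2F1 \<alpha> \<beta> \<gamma> z =
     (\<Sum>n. pochhammer \<alpha> n * pochhammer \<beta> n / pochhammer \<gamma> n * (z ^ n / fact n))"

text \<open>Only the values on the open interval from 0 to 1, for positive parameters with
  \<open>c + d - a - b > 0\<close>, are of interest.\<close>

definition W_weight :: "real \<Rightarrow> real \<Rightarrow> real \<Rightarrow> real \<Rightarrow> real \<Rightarrow> real" where
  "W_weight a b c d x =
     (let \<delta> = c + d - a - b in
        Gamma c * Gamma d / (Gamma a * Gamma b * Gamma \<delta>)
          * x powr (a - 1) * (1 - x) powr (\<delta> - 1) * hyp2F1 (c - b) (d - b) \<delta> (1 - x))"

definition step_line :: "nat \<Rightarrow> nat \<times> nat" where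
  "step_line n = (if even n then (n div 2, n div 2) else (n div 2 + 1, n div 2))"

definition linear_form ::
    "(real \<Rightarrow> real) \<Rightarrow> (real \<Rightarrow> real) \<Rightarrow> real poly \<Rightarrow> real poly \<Rightarrow> real \<Rightarrow> real" where
  "linear_form w0 w1 A B x = poly A x * w0 x + poly B x * w1 x"

text \<open>The type I conditions for the step-line index of length \<open>n \<ge> 1\<close>.  The library's
  \<open>degree 0\<close> is \<open>0\<close>, so the zero polynomial is admitted separately; for \<open>n0 = 0\<close> or
  \<open>n1 = 0\<close> it is then the only admissible one.  Using \<open>has_integral\<close> makes the
  existence of the integrals part of the conditions.\<close>

definition type_I_polys ::
    "(real \<Rightarrow> real) \<Rightarrow> (real \<Rightarrow> real) \<Rightarrow> nat \<Rightarrow> real poly \<Rightarrow> real poly \<Rightarrow> bool" where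
  "type_I_polys w0 w1 n A B \<longleftrightarrow>
     (case step_line n of (n0, n1) \<Rightarrow>
        (A = 0 \<or> degree A < n0) \<and> (B = 0 \<or> degree B < n1)) \<and>
     (\<forall>k. k + 2 \<le> n \<longrightarrow>
        ((\<lambda>x. x ^ k * linear_form w0 w1 A B x) has_integral 0) {0<..<1}) \<and>
     ((\<lambda>x. x ^ (n - 1) * linear_form w0 w1 A B x) has_integral 1) {0<..<1}"

text \<open>The definite description is meaningful when the pair of type I polynomials exists and
  is unique, as is the case for the weights below.\<close>

definition type_I_function ::
    "(real \<Rightarrow> real) \<Rightarrow> (real \<Rightarrow> real) \<Rightarrow> nat \<Rightarrow> real \<Rightarrow> real" where
  "type_I_function w0 w1 n =
     (case (THE (A, B). type_I_polys w0 w1 n A B) of (A, B) \<Rightarrow> linear_form w0 w1 A B)"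

definition Q_type_I :: "nat \<Rightarrow> real \<Rightarrow> real \<Rightarrow> real \<Rightarrow> real \<Rightarrow> real \<Rightarrow> real" where
  "Q_type_I n a b c d =
     type_I_function (W_weight a b c d) (W_weight a (b + 1) (c + 1) d) n"

end

theory Submission
  imports Defs "HOL-Real_Asymp.Real_Asymp"
begin

text \<open>Up to a constant, the Mellin transform of \<open>W_weight a b c d\<close> in the variable \<open>t\<close> is
  \<open>g t = Gamma (a + t) * Gamma (b + t) / (Gamma (c + t) * Gamma (d + t))\<close>. In terms of
  Mellin transforms, the claim is that \<open>t * (t - 1) * \<dots> * (t - n + 1)\<close> is a linear combination of
  \<open>(\<Prod>l<k. t + u l) * (\<Prod>l=k..<n. t + v l)\<close> for \<open>k \<le> n\<close>, where \<open>u\<close> runs through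
  \<open>b, a, b + 1, a + 1, \<dots>\<close> and \<open>v\<close> through \<open>c, d, c + 1, d + 1, \<dots>\<close>; these span the polynomials
  of degree at most \<open>n\<close> because no \<open>u l\<close> equals a later \<open>v m\<close>. Multiplication by \<open>t\<close> is realised
  on functions by \<open>f \<mapsto> - (x * f)'\<close>, and its action on the weights is given by contiguous relations of
  the hypergeometric series. The moments follow from Gauss' summation theorem.\<close>

section \<open>The hypergeometric series\<close>

definition hyp2F1_coeff :: "real \<Rightarrow> real \<Rightarrow> real \<Rightarrow> nat \<Rightarrow> real" where
  "hyp2F1_coeff \<alpha> \<beta> \<gamma> n = pochhammer \<alpha> n * pochhammer \<beta> n / (pochhammer \<gamma> n * fact n)"

lemma hyp2F1_coeff_0 [simp]: "hyp2F1_coeff \<alpha> \<beta> \<gamma> 0 = 1"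
  by (simp add: hyp2F1_coeff_def)

lemma hyp2F1_coeff_Suc:
  "hyp2F1_coeff \<alpha> \<beta> \<gamma> (Suc n) =
     hyp2F1_coeff \<alpha> \<beta> \<gamma> n * ((\<alpha> + real n) * (\<beta> + real n) / ((\<gamma> + real n) * (real n + 1)))"
  by (simp add: hyp2F1_coeff_def pochhammer_Suc mult_ac add_ac)

lemma hyp2F1_coeff_nonneg:
  "\<alpha> > 0 \<Longrightarrow> \<beta> > 0 \<Longrightarrow> \<gamma> > 0 \<Longrightarrow> hyp2F1_coeff \<alpha> \<beta> \<gamma> n \<ge> 0"
  by (simp add: hyp2F1_coeff_def pochhammer_nonneg)

lemma pochhammer_shift: "(z + real n) * pochhammer z n = z * pochhammer (z + 1) n"
  by (metis mult.commute pochhammer_Suc pochhammer_rec)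

lemma hyp2F1_coeff_lower_shift:
  assumes "\<gamma> > 0"
  shows "(\<gamma> + real n) * hyp2F1_coeff \<alpha> \<beta> (\<gamma> + 1) n = \<gamma> * hyp2F1_coeff \<alpha> \<beta> \<gamma> n"
proof -
  have "pochhammer \<gamma> n > 0" "pochhammer (\<gamma> + 1) n > 0"
    using assms by (auto intro!: pochhammer_pos)
  moreover have "pochhammer \<gamma> n = \<gamma> * pochhammer (\<gamma> + 1) n / (\<gamma> + real n)"
    using pochhammer_shift[of \<gamma> n] assms by (simp add: field_simps)
  ultimately show ?thesis
    using assms by (simp add: hyp2F1_coeff_def)
qed

text \<open>Stated without division because \<alpha> may vanish: \<open>hyp_weight_raise_b\<close>
  uses \<open>c - b - 1\<close> and \<open>d - b - 1\<close> as upper parameters, which need not be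
  positive.\<close>

lemma hyp2F1_coeff_upper_shift:
  "\<alpha> * hyp2F1_coeff (\<alpha> + 1) \<beta> \<gamma> n = (\<alpha> + real n) * hyp2F1_coeff \<alpha> \<beta> \<gamma> n"
  using pochhammer_shift[of \<alpha> n] by (simp add: hyp2F1_coeff_def flip: mult.assoc)

lemma hyp2F1_coeff_commute: "hyp2F1_coeff \<alpha> \<beta> \<gamma> n = hyp2F1_coeff \<beta> \<alpha> \<gamma> n"
  by (simp add: hyp2F1_coeff_def)

lemma summable_hyp2F1:
  assumes "\<gamma> > 0" "\<bar>z\<bar> < 1"
  shows "summable (\<lambda>n. hyp2F1_coeff \<alpha> \<beta> \<gamma> n * z ^ n)"
proof -
  let ?q = "\<lambda>n. \<bar>(\<alpha> + real n) * (\<beta> + real n) / ((\<gamma> + real n) * (real n + 1)) * z\<bar>"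
  have "?q \<longlonglongrightarrow> \<bar>1 * z\<bar>"
    by (intro tendsto_intros) real_asymp
  moreover have "\<bar>1 * z\<bar> < (1 + \<bar>z\<bar>) / 2"
    using assms by simp
  ultimately have "eventually (\<lambda>n. ?q n < (1 + \<bar>z\<bar>) / 2) sequentially"
    by (rule order_tendstoD)
  then obtain N where N: "?q n < (1 + \<bar>z\<bar>) / 2" if "n \<ge> N" for n
    by (auto simp: eventually_sequentially)
  show ?thesis
  proof (rule summable_ratio_test)
    show "(1 + \<bar>z\<bar>) / 2 < 1"
      using assms by simp
    fix n assume "n \<ge> N"
    let ?f = "hyp2F1_coeff \<alpha> \<beta> \<gamma> n * z ^ n"
    have "norm (hyp2F1_coeff \<alpha> \<beta> \<gamma> (Suc n) * z ^ Suc n) = ?q n * norm ?f"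
      by (simp add: hyp2F1_coeff_Suc abs_mult mult_ac)
    also have "\<dots> \<le> (1 + \<bar>z\<bar>) / 2 * norm ?f"
      using N[OF \<open>n \<ge> N\<close>] by (intro mult_right_mono) auto
    finally show "norm (hyp2F1_coeff \<alpha> \<beta> \<gamma> (Suc n) * z ^ Suc n) \<le> (1 + \<bar>z\<bar>) / 2 * norm ?f" .
  qed
qed

lemma hyp2F1_altdef: "hyp2F1 \<alpha> \<beta> \<gamma> z = (\<Sum>n. hyp2F1_coeff \<alpha> \<beta> \<gamma> n * z ^ n)"
  by (simp add: hyp2F1_def hyp2F1_coeff_def)

lemma hyp2F1_sums:
  "\<gamma> > 0 \<Longrightarrow> \<bar>z\<bar> < 1 \<Longrightarrow> (\<lambda>n. hyp2F1_coeff \<alpha> \<beta> \<gamma> n * z ^ n) sums hyp2F1 \<alpha> \<beta> \<gamma> z"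
  unfolding hyp2F1_altdef by (intro summable_sums summable_hyp2F1)

lemma hyp2F1_sums_Suc:
  assumes "\<gamma> > 0" "\<bar>z\<bar> < 1"
  shows "(\<lambda>n. hyp2F1_coeff \<alpha> \<beta> \<gamma> (Suc n) * z ^ Suc n) sums (hyp2F1 \<alpha> \<beta> \<gamma> z - 1)"
  using hyp2F1_sums[OF assms, of \<alpha> \<beta>] by (subst sums_Suc_iff) simp

lemma hyp2F1_commute: "hyp2F1 \<alpha> \<beta> \<gamma> z = hyp2F1 \<beta> \<alpha> \<gamma> z"
  by (simp add: hyp2F1_altdef hyp2F1_coeff_commute)

text \<open>Termwise, differentiating z^(\<gamma> + n) brings down \<gamma> + n, and this factor
  turns the coefficients for \<gamma> + 1 into \<gamma> times those for \<gamma>.\<close>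

lemma has_real_derivative_powr_hyp2F1:
  assumes "\<gamma> > 0" "0 < z" "z < 1"
  shows "((\<lambda>z. z powr \<gamma> * hyp2F1 \<alpha> \<beta> (\<gamma> + 1) z) has_real_derivative
           \<gamma> * z powr (\<gamma> - 1) * hyp2F1 \<alpha> \<beta> \<gamma> z) (at z)"
proof -
  let ?h = "hyp2F1_coeff \<alpha> \<beta> (\<gamma> + 1)"
  define F' where "F' = (\<Sum>n. diffs ?h n * z ^ n)"
  have sm: "summable (\<lambda>n. ?h n * w ^ n)" if "norm w < 1" for w
    using that assms by (intro summable_hyp2F1) auto
  have "((\<lambda>z. \<Sum>n. ?h n * z ^ n) has_real_derivative F') (at z)"
    unfolding F'_def using assms sm by (intro termdiffs_strong'[where K = 1]) auto
  then have "(hyp2F1 \<alpha> \<beta> (\<gamma> + 1) has_real_derivative F') (at z)"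
    by (simp add: hyp2F1_altdef [abs_def])
  then have D: "((\<lambda>z. z powr \<gamma> * hyp2F1 \<alpha> \<beta> (\<gamma> + 1) z) has_real_derivative
           \<gamma> * z powr (\<gamma> - 1) * hyp2F1 \<alpha> \<beta> (\<gamma> + 1) z + z powr \<gamma> * F') (at z)"
    using assms by (auto intro!: derivative_eq_intros)
  have "summable (\<lambda>n. diffs ?h n * z ^ n)"
    using assms sm by (intro termdiff_converges[where K = 1]) auto
  \<comment> \<open>Multiplication by z puts the derivative series back on the powers z^n, so that
    it can be added termwise to \<gamma> times the original series.\<close>
  from sums_mult[OF diffs_equiv[OF this], of z]
  have "(\<lambda>n. real n * ?h n * z ^ n) sums (z * F')"
    unfolding F'_def by (rule sums_cong[THEN iffD1, rotated]) (auto split: nat.split simp: power_eq_if)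
  then have "(\<lambda>n. \<gamma> * (?h n * z ^ n) + real n * ?h n * z ^ n) sums
      (\<gamma> * hyp2F1 \<alpha> \<beta> (\<gamma> + 1) z + z * F')"
    using assms by (intro sums_add sums_mult hyp2F1_sums) auto
  moreover have "\<gamma> * (?h n * z ^ n) + real n * ?h n * z ^ n
      = \<gamma> * (hyp2F1_coeff \<alpha> \<beta> \<gamma> n * z ^ n)" for n
    using arg_cong[OF hyp2F1_coeff_lower_shift[OF assms(1), of n \<alpha> \<beta>], of "\<lambda>u. u * z ^ n"]
    by (simp add: algebra_simps)
  moreover have "(\<lambda>n. \<gamma> * (hyp2F1_coeff \<alpha> \<beta> \<gamma> n * z ^ n)) sums (\<gamma> * hyp2F1 \<alpha> \<beta> \<gamma> z)"
    using assms by (intro sums_mult hyp2F1_sums) auto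
  ultimately have eq: "\<gamma> * hyp2F1 \<alpha> \<beta> (\<gamma> + 1) z + z * F' = \<gamma> * hyp2F1 \<alpha> \<beta> \<gamma> z"
    by (auto dest: sums_unique2)
  have "z powr \<gamma> = z powr (\<gamma> - 1) * z"
    using assms powr_mult_base[of z "\<gamma> - 1"] by (simp add: mult.commute)
  then have "\<gamma> * z powr (\<gamma> - 1) * hyp2F1 \<alpha> \<beta> (\<gamma> + 1) z + z powr \<gamma> * F'
      = z powr (\<gamma> - 1) * (\<gamma> * hyp2F1 \<alpha> \<beta> (\<gamma> + 1) z + z * F')"
    by (simp add: algebra_simps)
  with D show ?thesis
    unfolding eq by (simp add: mult_ac)
qed

text \<open>Both contiguous relations compare coefficients of \<open>z ^ Suc n\<close> as multiples of the
  coefficient of \<open>z ^ n\<close> in the series with raised upper parameters.\<close>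

lemma hyp2F1_contiguous_upper_one:
  assumes "\<gamma> > 0" "\<bar>z\<bar> < 1"
  shows "(1 - z) * hyp2F1 (\<alpha> + 1) \<beta> \<gamma> z
           + (\<gamma> - \<beta>) / \<gamma> * z * hyp2F1 (\<alpha> + 1) \<beta> (\<gamma> + 1) z = hyp2F1 \<alpha> \<beta> \<gamma> z"
proof -
  let ?f = "hyp2F1_coeff (\<alpha> + 1) \<beta> \<gamma>" and ?g = "hyp2F1_coeff (\<alpha> + 1) \<beta> (\<gamma> + 1)"
  have "(\<lambda>n. ?f (Suc n) * z ^ Suc n - z * (?f n * z ^ n) + (\<gamma> - \<beta>) / \<gamma> * z * (?g n * z ^ n)) sums
      ((hyp2F1 (\<alpha> + 1) \<beta> \<gamma> z - 1) - z * hyp2F1 (\<alpha> + 1) \<beta> \<gamma> z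
        + (\<gamma> - \<beta>) / \<gamma> * z * hyp2F1 (\<alpha> + 1) \<beta> (\<gamma> + 1) z)"
    using assms by (intro sums_add sums_diff sums_mult hyp2F1_sums hyp2F1_sums_Suc) auto
  moreover have "?f (Suc n) * z ^ Suc n - z * (?f n * z ^ n) + (\<gamma> - \<beta>) / \<gamma> * z * (?g n * z ^ n)
      = hyp2F1_coeff \<alpha> \<beta> \<gamma> (Suc n) * z ^ Suc n" for n
  proof -
    have pos: "\<gamma> + real n > 0" "\<gamma> > 0" "real n + 1 > 0"
      using assms by auto
    have g: "?g n = \<gamma> * ?f n / (\<gamma> + real n)"
      using hyp2F1_coeff_lower_shift[OF assms(1), of n "\<alpha> + 1" \<beta>] pos by (simp add: field_simps)
    have e: "hyp2F1_coeff \<alpha> \<beta> \<gamma> (Suc n) = \<alpha> * ?f n * (\<beta> + real n) / ((\<gamma> + real n) * (real n + 1))"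
      by (simp add: hyp2F1_coeff_Suc hyp2F1_coeff_upper_shift)
    have "?f (Suc n) - ?f n + (\<gamma> - \<beta>) / \<gamma> * ?g n = hyp2F1_coeff \<alpha> \<beta> \<gamma> (Suc n)"
      unfolding e g hyp2F1_coeff_Suc[of "\<alpha> + 1"] using pos
      by (simp add: divide_simps) (simp add: algebra_simps)
    from arg_cong[OF this, of "\<lambda>u. u * z ^ Suc n"] show ?thesis
      by (simp add: algebra_simps)
  qed
  moreover have "(\<lambda>n. hyp2F1_coeff \<alpha> \<beta> \<gamma> (Suc n) * z ^ Suc n) sums (hyp2F1 \<alpha> \<beta> \<gamma> z - 1)"
    using assms by (intro hyp2F1_sums_Suc)
  ultimately show ?thesis
    by (auto dest: sums_unique2 simp: algebra_simps)
qed

lemma hyp2F1_contiguous_upper_both: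
  assumes "\<gamma> > 0" "\<bar>z\<bar> < 1"
  shows "(1 - z) * hyp2F1 (\<alpha> + 1) (\<beta> + 1) \<gamma> z
           + (\<gamma> - 1 - \<alpha> - \<beta>) / \<gamma> * z * hyp2F1 (\<alpha> + 1) (\<beta> + 1) (\<gamma> + 1) z = hyp2F1 \<alpha> \<beta> \<gamma> z"
proof -
  let ?f = "hyp2F1_coeff (\<alpha> + 1) (\<beta> + 1) \<gamma>" and ?g = "hyp2F1_coeff (\<alpha> + 1) (\<beta> + 1) (\<gamma> + 1)"
  let ?r = "(\<gamma> - 1 - \<alpha> - \<beta>) / \<gamma>"
  have "(\<lambda>n. ?f (Suc n) * z ^ Suc n - z * (?f n * z ^ n) + ?r * z * (?g n * z ^ n)) sums
      ((hyp2F1 (\<alpha> + 1) (\<beta> + 1) \<gamma> z - 1) - z * hyp2F1 (\<alpha> + 1) (\<beta> + 1) \<gamma> z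
        + ?r * z * hyp2F1 (\<alpha> + 1) (\<beta> + 1) (\<gamma> + 1) z)"
    using assms by (intro sums_add sums_diff sums_mult hyp2F1_sums hyp2F1_sums_Suc) auto
  moreover have "?f (Suc n) * z ^ Suc n - z * (?f n * z ^ n) + ?r * z * (?g n * z ^ n)
      = hyp2F1_coeff \<alpha> \<beta> \<gamma> (Suc n) * z ^ Suc n" for n
  proof -
    have pos: "\<gamma> + real n > 0" "\<gamma> > 0" "real n + 1 > 0"
      using assms by auto
    have g: "?g n = \<gamma> * ?f n / (\<gamma> + real n)"
      using hyp2F1_coeff_lower_shift[OF assms(1), of n "\<alpha> + 1" "\<beta> + 1"] pos by (simp add: field_simps)
    have f: "\<alpha> * \<beta> * ?f n = (\<alpha> + real n) * (\<beta> + real n) * hyp2F1_coeff \<alpha> \<beta> \<gamma> n"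
      using hyp2F1_coeff_upper_shift[of \<alpha> "\<beta> + 1" \<gamma> n] hyp2F1_coeff_upper_shift[of \<beta> \<alpha> \<gamma> n]
      by (simp add: hyp2F1_coeff_commute mult_ac) (metis hyp2F1_coeff_commute mult.left_commute)
    have e: "hyp2F1_coeff \<alpha> \<beta> \<gamma> (Suc n) = \<alpha> * \<beta> * ?f n / ((\<gamma> + real n) * (real n + 1))"
      by (simp add: f hyp2F1_coeff_Suc)
    have "?f (Suc n) - ?f n + ?r * ?g n = hyp2F1_coeff \<alpha> \<beta> \<gamma> (Suc n)"
      unfolding e g hyp2F1_coeff_Suc[of "\<alpha> + 1"] using pos
      by (simp add: divide_simps) (simp add: algebra_simps)
    from arg_cong[OF this, of "\<lambda>u. u * z ^ Suc n"] show ?thesis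
      by (simp add: algebra_simps)
  qed
  moreover have "(\<lambda>n. hyp2F1_coeff \<alpha> \<beta> \<gamma> (Suc n) * z ^ Suc n) sums (hyp2F1 \<alpha> \<beta> \<gamma> z - 1)"
    using assms by (intro hyp2F1_sums_Suc)
  ultimately show ?thesis
    by (auto dest: sums_unique2 simp: algebra_simps)
qed

section \<open>Gauss' summation theorem\<close>

lemma has_integral_sums_nonneg:
  fixes f :: "nat \<Rightarrow> real \<Rightarrow> real"
  assumes int: "\<And>n. (f n has_integral I n) S"
    and nonneg: "\<And>n x. x \<in> S \<Longrightarrow> f n x \<ge> 0"
    and sums: "\<And>x. x \<in> S \<Longrightarrow> (\<lambda>n. f n x) sums g x"
    and J: "I sums J"
  shows "(g has_integral J) S"
proof (rule has_integral_monotone_convergence_increasing)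
  show "((\<lambda>x. \<Sum>n<k. f n x) has_integral (\<Sum>n<k. I n)) S" for k
    by (intro has_integral_sum int) auto
  show "(\<Sum>n<k. f n x) \<le> (\<Sum>n<Suc k. f n x)" if "x \<in> S" for k x
    using nonneg[OF that] by simp
  show "(\<lambda>k. \<Sum>n<k. f n x) \<longlonglongrightarrow> g x" if "x \<in> S" for x
    using sums[OF that] by (simp add: sums_def)
  show "(\<lambda>k. \<Sum>n<k. I n) \<longlonglongrightarrow> J"
    using J by (simp add: sums_def)
qed

text \<open>Here a known integral evaluates the series, instead of the reverse: the integral bounds
  the partial sums, so the series converges, and monotone convergence identifies its sum.\<close>

lemma sums_of_has_integral_nonneg:
  fixes f :: "nat \<Rightarrow> real \<Rightarrow> real"
  assumes int: "\<And>n. (f n has_integral I n) S"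
    and nonneg: "\<And>n x. x \<in> S \<Longrightarrow> f n x \<ge> 0"
    and sums: "\<And>x. x \<in> S \<Longrightarrow> (\<lambda>n. f n x) sums g x"
    and J: "(g has_integral J) S"
  shows "I sums J"
proof -
  have "I n \<ge> 0" for n
    by (rule has_integral_nonneg[OF int nonneg])
  moreover have "(\<Sum>i<n. I i) \<le> J" for n
  proof (rule has_integral_le[OF _ J])
    show "((\<lambda>x. \<Sum>i<n. f i x) has_integral (\<Sum>i<n. I i)) S"
      by (intro has_integral_sum int) auto
    show "(\<Sum>i<n. f i x) \<le> g x" if "x \<in> S" for x
      using sum_le_suminf[of "\<lambda>n. f n x" "{..<n}"] sums[OF that] nonneg[OF that]
      by (auto simp: sums_iff)
  qed
  ultimately have "summable I"
    by (intro summableI_nonneg_bounded)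
  then have "I sums suminf I"
    by (rule summable_sums)
  with has_integral_sums_nonneg[OF int nonneg sums this] J show ?thesis
    by (metis has_integral_unique)
qed

lemma has_integral_Beta_Ioo:
  "a > 0 \<Longrightarrow> b > (0 :: real) \<Longrightarrow>
    ((\<lambda>t. t powr (a - 1) * (1 - t) powr (b - 1)) has_integral Beta a b) {0<..<1}"
  using has_integral_Beta_real[of a b] by (simp add: has_integral_Icc_iff_Ioo)

lemma Gamma_real_neq_0: "z > 0 \<Longrightarrow> Gamma (z :: real) \<noteq> 0"
  using Gamma_real_pos[of z] by (metis less_irrefl)

lemma Gamma_pochhammer: "z > 0 \<Longrightarrow> Gamma (z + real n) = pochhammer z n * Gamma (z :: real)"
  using pochhammer_Gamma[of z n] nonpos_Ints_nonpos[of z] Gamma_real_neq_0[of z]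
  by (cases "z \<in> \<int>\<^sub>\<le>\<^sub>0") (auto simp: field_simps)

text \<open>Expand \<open>(1 - t) powr -\<alpha>\<close> binomially in the Beta integral for
  \<open>Beta \<beta> (\<gamma> - \<alpha> - \<beta>)\<close> and integrate term by term.\<close>

lemma Gauss_summation:
  assumes "\<alpha> > 0" "\<beta> > 0" "\<gamma> > \<alpha> + \<beta>"
  shows "hyp2F1_coeff \<alpha> \<beta> \<gamma> sums
           (Gamma \<gamma> * Gamma (\<gamma> - \<alpha> - \<beta>) / (Gamma (\<gamma> - \<alpha>) * Gamma (\<gamma> - \<beta>)))"
proof -
  let ?f = "\<lambda>n t. pochhammer \<alpha> n / fact n * (t powr (\<beta> + real n - 1) * (1 - t) powr (\<gamma> - \<beta> - 1))"
  let ?I = "\<lambda>n. pochhammer \<alpha> n / fact n * Beta (\<beta> + real n) (\<gamma> - \<beta>)"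
  let ?g = "\<lambda>t. t powr (\<beta> - 1) * (1 - t) powr (\<gamma> - \<alpha> - \<beta> - 1)"
  have "?I sums Beta \<beta> (\<gamma> - \<alpha> - \<beta>)"
  proof (rule sums_of_has_integral_nonneg)
    show "(?f n has_integral ?I n) {0<..<1}" for n
      using assms by (intro has_integral_mult_right has_integral_Beta_Ioo) auto
    show "?f n t \<ge> 0" if "t \<in> {0<..<1}" for n t
      using assms by (auto intro!: mult_nonneg_nonneg divide_nonneg_nonneg pochhammer_nonneg)
    show "(?g has_integral Beta \<beta> (\<gamma> - \<alpha> - \<beta>)) {0<..<1}"
      using assms by (intro has_integral_Beta_Ioo) auto
    show "(\<lambda>n. ?f n t) sums ?g t" if "t \<in> {0<..<1}" for t
    proof -
      have "(\<lambda>n. (-\<alpha> gchoose n) * (-t) ^ n) sums (1 + -t) powr (-\<alpha>)"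
        using that by (intro gen_binomial_real) auto
      moreover have "(-\<alpha> gchoose n) * (-t) ^ n = pochhammer \<alpha> n / fact n * t ^ n" for n
        by (simp add: gbinomial_pochhammer power_minus[of t] flip: power_add mult_2)
      ultimately have "(\<lambda>n. t powr (\<beta> - 1) * (1 - t) powr (\<gamma> - \<beta> - 1) * (pochhammer \<alpha> n / fact n * t ^ n))
          sums (t powr (\<beta> - 1) * (1 - t) powr (\<gamma> - \<beta> - 1) * (1 - t) powr (-\<alpha>))"
        by (intro sums_mult) simp
      moreover have "t powr (\<beta> + real n - 1) = t powr (\<beta> - 1) * t ^ n" for n
        using that by (simp add: powr_add[symmetric] flip: powr_realpow) (simp add: algebra_simps)
      moreover have "(1 - t) powr (\<gamma> - \<beta> - 1) * (1 - t) powr (-\<alpha>) = (1 - t) powr (\<gamma> - \<alpha> - \<beta> - 1)"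
        using that by (simp add: powr_add[symmetric] algebra_simps)
      ultimately show ?thesis
        by (simp add: mult_ac)
    qed
  qed
  then have "(\<lambda>n. ?I n / Beta \<beta> (\<gamma> - \<beta>)) sums (Beta \<beta> (\<gamma> - \<alpha> - \<beta>) / Beta \<beta> (\<gamma> - \<beta>))"
    by (rule sums_divide)
  \<comment> \<open>The quotient of the Beta values is (\<beta>)_n / (\<gamma>)_n, which completes
    (\<alpha>)_n / n! to the hypergeometric coefficient.\<close>
  moreover have "?I n / Beta \<beta> (\<gamma> - \<beta>) = hyp2F1_coeff \<alpha> \<beta> \<gamma> n" for n
  proof -
    have "Gamma (\<beta> + real n + (\<gamma> - \<beta>)) = pochhammer \<gamma> n * Gamma \<gamma>"
      using Gamma_pochhammer[of \<gamma> n] assms by (simp add: add_ac)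
    moreover have "pochhammer \<gamma> n > 0"
      using assms by (auto intro!: pochhammer_pos)
    moreover have "Gamma \<gamma> \<noteq> 0" "Gamma \<beta> \<noteq> 0" "Gamma (\<gamma> - \<beta>) \<noteq> 0"
      using assms by (simp_all add: Gamma_real_neq_0)
    ultimately show ?thesis
      using assms by (simp add: Beta_def hyp2F1_coeff_def Gamma_pochhammer field_simps)
  qed
  moreover have "Gamma \<gamma> \<noteq> 0" "Gamma \<beta> \<noteq> 0" "Gamma (\<gamma> - \<beta>) \<noteq> 0" "Gamma (\<gamma> - \<alpha>) \<noteq> 0"
    using assms by (simp_all add: Gamma_real_neq_0)
  ultimately show ?thesis
    by (simp add: Beta_def field_simps)
qed

section \<open>The weights and their moments\<close>

text \<open>\<open>W_weight\<close> without the Gamma factors in a, b, c, d but with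
  \<open>1 / Gamma (c + d - a - b)\<close>: this makes the coefficients of the contiguous and
  derivative relations polynomial in the parameters.\<close>

definition hyp_weight :: "real \<Rightarrow> real \<Rightarrow> real \<Rightarrow> real \<Rightarrow> real \<Rightarrow> real" where
  "hyp_weight a b c d x =
     x powr (a - 1) * (1 - x) powr (c + d - a - b - 1)
       * (hyp2F1 (c - b) (d - b) (c + d - a - b) (1 - x) / Gamma (c + d - a - b))"

text \<open>Intended as the integral of \<open>hyp_weight\<close> over (0, 1); with t added to all
  four arguments it becomes the t-th moment.\<close>

definition hyp_moment :: "real \<Rightarrow> real \<Rightarrow> real \<Rightarrow> real \<Rightarrow> real" where
  "hyp_moment a b c d = Gamma a * Gamma b / (Gamma c * Gamma d)"

lemma W_weight_eq_hyp_weight: "W_weight a b c d x = hyp_weight a b c d x / hyp_moment a b c d"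
  by (simp add: W_weight_def hyp_weight_def hyp_moment_def Let_def mult_ac)

lemma hyp_moment_pos: "a > 0 \<Longrightarrow> b > 0 \<Longrightarrow> c > 0 \<Longrightarrow> d > 0 \<Longrightarrow> hyp_moment a b c d > 0"
  by (simp add: hyp_moment_def Gamma_real_pos)

lemma hyp_weight_commute: "hyp_weight a b c d x = hyp_weight a b d c x"
  by (simp add: hyp_weight_def hyp2F1_commute[of "c - b"] add.commute)

lemma hyp_moment_commute: "hyp_moment a b c d = hyp_moment a b d c"
  by (simp add: hyp_moment_def mult.commute)

lemma Gamma_plus1_pos: "z > 0 \<Longrightarrow> Gamma (z + 1) = z * Gamma (z :: real)"
  using Gamma_pochhammer[of z 1] by simp

lemma hyp_moment_raise:
  assumes "a > 0" "b > 0" "c > 0" "d > 0"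
  shows "hyp_moment (a + 1) b c d = a * hyp_moment a b c d"
    and "hyp_moment a (b + 1) c d = b * hyp_moment a b c d"
    and "hyp_moment a b c d = c * hyp_moment a b (c + 1) d"
  using assms by (simp_all add: hyp_moment_def Gamma_plus1_pos)

section \<open>Shifts, contiguous relations, derivatives and moments of the weights\<close>

lemma power_mult_hyp_weight:
  assumes "x > 0"
  shows "x ^ t * hyp_weight a b c d x =
    hyp_weight (a + real t) (b + real t) (c + real t) (d + real t) x"
proof -
  have "x powr (a + real t - 1) = x ^ t * x powr (a - 1)"
    using assms powr_add[of x "real t" "a - 1"] by (simp add: powr_realpow algebra_simps)
  then show ?thesis
    by (simp add: hyp_weight_def algebra_simps)
qed

text \<open>Under the Mellin transform this is c + t = (a + t) + (c - a). On the series it is the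
  contiguous relation raising one upper parameter, at 1 - x.\<close>

lemma hyp_weight_raise_c:
  assumes "c + d > a + b" "x \<in> {0<..<1}"
  shows "hyp_weight a b c d x = hyp_weight (a + 1) b (c + 1) d x + (c - a) * hyp_weight a b (c + 1) d x"
proof -
  define g where "g = c + d - a - b"
  have g: "g > 0" "c + 1 + d - (a + 1) - b = g" "c + 1 + d - a - b = g + 1" "g - (d - b) = c - a"
    using assms by (simp_all add: g_def)
  define K where "K = x powr (a - 1) * (1 - x) powr (g - 1) / Gamma g"
  have "x powr (a + 1 - 1) = x powr (a - 1) * x" "(1 - x) powr (g + 1 - 1) = (1 - x) powr (g - 1) * (1 - x)"
    using assms powr_mult_base[of x "a - 1"] powr_mult_base[of "1 - x" "g - 1"]
    by (simp_all add: mult.commute)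
  then have "hyp_weight (a + 1) b (c + 1) d x + (c - a) * hyp_weight a b (c + 1) d x
    = K * (x * hyp2F1 (c - b + 1) (d - b) g (1 - x)
        + (c - a) / g * (1 - x) * hyp2F1 (c - b + 1) (d - b) (g + 1) (1 - x))"
    using less_imp_neq[OF g(1), symmetric] Gamma_real_neq_0[OF g(1)] g(1)
    by (simp only: hyp_weight_def g Gamma_plus1_pos K_def) (simp add: field_simps)
  also have "\<dots> = K * hyp2F1 (c - b) (d - b) g (1 - x)"
    using hyp2F1_contiguous_upper_one[of g "1 - x" "c - b" "d - b"] assms g by simp
  also have "\<dots> = hyp_weight a b c d x"
    by (simp add: hyp_weight_def K_def g_def)
  finally show ?thesis ..
qed

text \<open>Under the Mellin transform this is b + t = (a + t) + (b - a). As b enters both upper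
  parameters, the contiguous relation raising both is needed.\<close>

lemma hyp_weight_raise_b:
  assumes "c + d > a + b + 1" "x \<in> {0<..<1}"
  shows "hyp_weight a (b + 1) c d x = hyp_weight (a + 1) b c d x + (b - a) * hyp_weight a b c d x"
proof -
  define g where "g = c + d - a - b - 1"
  have g: "g > 0" "c + d - (a + 1) - b = g" "c + d - a - b = g + 1" "c + d - a - (b + 1) = g"
    using assms by (simp_all add: g_def)
  have h: "g - 1 - (c - b - 1) - (d - b - 1) = b - a" "c - b - 1 + 1 = c - b" "d - b - 1 + 1 = d - b"
    by (simp_all add: g_def)
  define K where "K = x powr (a - 1) * (1 - x) powr (g - 1) / Gamma g"
  have "x powr (a + 1 - 1) = x powr (a - 1) * x" "(1 - x) powr (g + 1 - 1) = (1 - x) powr (g - 1) * (1 - x)"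
    using assms powr_mult_base[of x "a - 1"] powr_mult_base[of "1 - x" "g - 1"]
    by (simp_all add: mult.commute)
  then have "hyp_weight (a + 1) b c d x + (b - a) * hyp_weight a b c d x
    = K * (x * hyp2F1 (c - b) (d - b) g (1 - x)
        + (b - a) / g * (1 - x) * hyp2F1 (c - b) (d - b) (g + 1) (1 - x))"
    using less_imp_neq[OF g(1), symmetric] Gamma_real_neq_0[OF g(1)] g(1)
    by (simp only: hyp_weight_def g Gamma_plus1_pos K_def) (simp add: field_simps)
  also have "\<dots> = K * hyp2F1 (c - b - 1) (d - b - 1) g (1 - x)"
    using hyp2F1_contiguous_upper_both[of g "1 - x" "c - b - 1" "d - b - 1"] assms g(1)
    unfolding h by simp
  also have "\<dots> = hyp_weight a (b + 1) c d x"
    by (simp only: hyp_weight_def g K_def) (simp add: algebra_simps)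
  finally show ?thesis ..
qed

text \<open>In x^a \<phi>(1 - x) / Gamma (g + 1), differentiating x^a yields the factor a, while
  differentiating \<phi> lowers its exponent and lower parameter by one, as raising a does. The
  hypothesis keeps the lowered parameter positive.\<close>

lemma DERIV_times_hyp_weight_a:
  assumes "c + d > a + b + 1" "x \<in> {0<..<1}"
  shows "((\<lambda>x. x * hyp_weight a b c d x) has_real_derivative
           a * hyp_weight a b c d x - hyp_weight (a + 1) b c d x) (at x)"
proof -
  define g where "g = c + d - a - b - 1"
  have g: "g > 0" "c + d - (a + 1) - b = g" "c + d - a - b = g + 1"
    using assms by (simp_all add: g_def)
  let ?\<phi> = "\<lambda>z. z powr g * hyp2F1 (c - b) (d - b) (g + 1) z"
  let ?\<phi>' = "g * (1 - x) powr (g - 1) * hyp2F1 (c - b) (d - b) g (1 - x)"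
  have "((\<lambda>x. ?\<phi> (1 - x)) has_real_derivative ?\<phi>' * (-1)) (at x)"
  proof (rule DERIV_chain2[of ?\<phi>])
    show "(?\<phi> has_real_derivative ?\<phi>') (at (1 - x))"
      using assms g by (intro has_real_derivative_powr_hyp2F1) auto
  qed (auto intro!: derivative_eq_intros)
  moreover have "((\<lambda>x. x powr a) has_real_derivative a * x powr (a - 1)) (at x)"
    using assms by (auto intro!: derivative_eq_intros)
  ultimately have "((\<lambda>x. x powr a * ?\<phi> (1 - x) / Gamma (g + 1)) has_real_derivative
      (a * x powr (a - 1) * ?\<phi> (1 - x) + ?\<phi>' * (-1) * x powr a) / Gamma (g + 1)) (at x)"
    by (intro DERIV_cdivide DERIV_mult)
  moreover have "(a * x powr (a - 1) * ?\<phi> (1 - x) + ?\<phi>' * (-1) * x powr a) / Gamma (g + 1)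
      = a * hyp_weight a b c d x - hyp_weight (a + 1) b c d x"
    using less_imp_neq[OF g(1), symmetric] Gamma_real_neq_0[OF g(1)] g(1)
    by (simp only: hyp_weight_def g Gamma_plus1_pos) (simp add: field_simps)
  ultimately have D: "((\<lambda>x. x powr a * ?\<phi> (1 - x) / Gamma (g + 1)) has_real_derivative
      a * hyp_weight a b c d x - hyp_weight (a + 1) b c d x) (at x)"
    by simp
  show ?thesis
  proof (rule has_field_derivative_transform_within_open[OF D])
    show "open {0<..<1::real}" "x \<in> {0<..<1}"
      using assms by auto
    show "y powr a * ?\<phi> (1 - y) / Gamma (g + 1) = y * hyp_weight a b c d y" if "y \<in> {0<..<1}" for y
      using that powr_mult_base[of y "a - 1"] by (simp only: hyp_weight_def g) (simp add: mult_ac)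
  qed
qed

text \<open>On the Mellin side, -t is written as p - (p + t) for each of the four parameters p. The
  contiguous relations carry the rule for a over to b and c; the rule for d follows by
  symmetry.\<close>

lemma DERIV_times_hyp_weight_b:
  assumes "c + d > a + b + 1" "x \<in> {0<..<1}"
  shows "((\<lambda>x. x * hyp_weight a b c d x) has_real_derivative
           b * hyp_weight a b c d x - hyp_weight a (b + 1) c d x) (at x)"
  using DERIV_times_hyp_weight_a[OF assms] unfolding hyp_weight_raise_b[OF assms]
  by (simp add: left_diff_distrib)

lemma DERIV_times_hyp_weight_c:
  assumes "c + d > a + b" "x \<in> {0<..<1}"
  shows "((\<lambda>x. x * hyp_weight a b (c + 1) d x) has_real_derivative
           c * hyp_weight a b (c + 1) d x - hyp_weight a b c d x) (at x)"
  using DERIV_times_hyp_weight_a[of a b "c + 1" d] assms unfolding hyp_weight_raise_c[OF assms]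
  by (simp add: left_diff_distrib)

lemma DERIV_times_hyp_weight_d:
  assumes "c + d > a + b" "x \<in> {0<..<1}"
  shows "((\<lambda>x. x * hyp_weight a b c (d + 1) x) has_real_derivative
           d * hyp_weight a b c (d + 1) x - hyp_weight a b c d x) (at x)"
  using DERIV_times_hyp_weight_c[of a b d c x] assms
  unfolding hyp_weight_commute[of a b c] by (simp add: add.commute)

text \<open>Expanding in powers of 1 - x gives Beta integrals, whose sum is a hypergeometric series
  at 1 covered by Gauss' theorem. The conditions \<open>c > b\<close> and \<open>d > b\<close> make
  all terms nonnegative.\<close>

lemma has_integral_hyp_weight_aux:
  assumes "a > 0" "b > 0" "c > b" "d > b" "c + d > a + b"
  shows "(hyp_weight a b c d has_integral hyp_moment a b c d) {0<..<1}"
proof (rule has_integral_sums_nonneg)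
  define g where "g = c + d - a - b"
  have g: "g > 0" "a + g = c + d - b"
    using assms by (simp_all add: g_def)
  let ?C = "hyp2F1_coeff (c - b) (d - b) g"
  let ?f = "\<lambda>n x. ?C n / Gamma g * (x powr (a - 1) * (1 - x) powr (g + real n - 1))"
  let ?I = "\<lambda>n. ?C n / Gamma g * Beta a (g + real n)"
  have pos: "Gamma g > 0" "Gamma g \<noteq> 0" "Gamma (c + d - b) \<noteq> 0"
    using assms g(1) by (simp_all add: Gamma_real_pos Gamma_real_neq_0)
  show "(?f n has_integral ?I n) {0<..<1}" for n
    using assms g by (intro has_integral_mult_right has_integral_Beta_Ioo) auto
  show "?f n x \<ge> 0" for n x
    using assms g pos by (auto intro!: mult_nonneg_nonneg divide_nonneg_nonneg hyp2F1_coeff_nonneg)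
  show "(\<lambda>n. ?f n x) sums hyp_weight a b c d x" if "x \<in> {0<..<1}" for x
  proof -
    have "(\<lambda>n. x powr (a - 1) * (1 - x) powr (g - 1) / Gamma g * (?C n * (1 - x) ^ n))
      sums (x powr (a - 1) * (1 - x) powr (g - 1) / Gamma g * hyp2F1 (c - b) (d - b) g (1 - x))"
      using that g by (intro sums_mult hyp2F1_sums) auto
    moreover have "(1 - x) powr (g + real n - 1) = (1 - x) powr (g - 1) * (1 - x) ^ n" for n
      using that powr_add[of "1 - x" "g - 1" "real n"] by (simp add: powr_realpow algebra_simps)
    ultimately show ?thesis
      by (simp add: hyp_weight_def mult_ac flip: g_def)
  qed
  \<comment> \<open>Integration trades the lower parameter g for \<open>a + g\<close>, that is
    \<open>c + d - b\<close>; the excess required by Gauss' theorem is then b.\<close>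
  have "?I n = Gamma a / Gamma (c + d - b) * hyp2F1_coeff (c - b) (d - b) (c + d - b) n" for n
  proof -
    have "Gamma (a + (g + real n)) = pochhammer (c + d - b) n * Gamma (c + d - b)"
      using Gamma_pochhammer[of "c + d - b" n] g assms by (simp add: add.assoc[symmetric])
    moreover have "pochhammer (c + d - b) n > 0" "pochhammer g n > 0"
      using assms g by (auto intro!: pochhammer_pos)
    ultimately show ?thesis
      using pos g assms by (simp add: Beta_def Gamma_pochhammer hyp2F1_coeff_def field_simps)
  qed
  moreover have "(\<lambda>n. Gamma a / Gamma (c + d - b) * hyp2F1_coeff (c - b) (d - b) (c + d - b) n) sums
     (Gamma a / Gamma (c + d - b) * (Gamma (c + d - b) * Gamma (c + d - b - (c - b) - (d - b)) /
       (Gamma (c + d - b - (c - b)) * Gamma (c + d - b - (d - b)))))"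
    using assms by (intro sums_mult Gauss_summation) auto
  ultimately show "?I sums hyp_moment a b c d"
    using pos by (simp add: hyp_moment_def mult_ac)
qed

text \<open>The contiguous relation extends the moment formula from \<open>d > b\<close> to \<open>d > b - 1\<close>.\<close>

lemma has_integral_hyp_weight:
  assumes "a > 0" "b > 0" "c > b" "d > 0" "d + 1 > b" "c + d > a + b"
  shows "(hyp_weight a b c d has_integral hyp_moment a b c d) {0<..<1}"
proof -
  have "((\<lambda>x. hyp_weight (a + 1) b (d + 1) c x + (d - a) * hyp_weight a b (d + 1) c x) has_integral
      (hyp_moment (a + 1) b (d + 1) c + (d - a) * hyp_moment a b (d + 1) c)) {0<..<1}"
    using assms by (intro has_integral_add has_integral_mult_right has_integral_hyp_weight_aux) auto
  also have "hyp_moment (a + 1) b (d + 1) c + (d - a) * hyp_moment a b (d + 1) c = hyp_moment a b c d"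
    using assms hyp_moment_raise[of a b "d + 1" c] hyp_moment_raise(3)[of a b d c]
    by (simp add: hyp_moment_commute[of a b c] algebra_simps)
  finally show ?thesis
    by (rule has_integral_eq[rotated])
      (use assms hyp_weight_raise_c[of a b d c] in \<open>simp add: hyp_weight_commute[of a b c]\<close>)
qed

section \<open>Uniqueness of type I functions\<close>

lemma degree_bound_iff: "p = 0 \<or> degree p < m \<longleftrightarrow> (\<forall>i\<ge>m. coeff p i = 0)"
proof
  show "\<forall>i\<ge>m. coeff p i = 0" if "p = 0 \<or> degree p < m"
    using that by (auto simp: coeff_eq_0)
  show "p = 0 \<or> degree p < m" if "\<forall>i\<ge>m. coeff p i = 0"
    using that by (metis leading_coeff_0_iff not_le)
qed

text \<open>The degree bounds are put as vanishing coefficients: in this form they are linear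
  conditions and need no separate case for the zero polynomial.\<close>

definition step_degrees :: "nat \<Rightarrow> real poly \<Rightarrow> real poly \<Rightarrow> bool" where
  "step_degrees n A B \<longleftrightarrow>
     (\<forall>i \<ge> (n + 1) div 2. coeff A i = 0) \<and> (\<forall>i \<ge> n div 2. coeff B i = 0)"

lemma type_I_polys_iff:
  "type_I_polys w0 w1 n A B \<longleftrightarrow> step_degrees n A B \<and>
     (\<forall>k. k + 2 \<le> n \<longrightarrow> ((\<lambda>x. x ^ k * linear_form w0 w1 A B x) has_integral 0) {0<..<1}) \<and>
     ((\<lambda>x. x ^ (n - 1) * linear_form w0 w1 A B x) has_integral 1) {0<..<1}"
  by (auto simp: type_I_polys_def step_degrees_def step_line_def degree_bound_iff)

lemma step_degrees_add_smult:
  "step_degrees n A B \<Longrightarrow> step_degrees n A' B' \<Longrightarrow> step_degrees n (A + smult r A') (B + smult r B')"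
  by (simp add: step_degrees_def)

lemma step_degrees_Suc: "step_degrees n A B \<Longrightarrow> step_degrees (Suc n) A B"
  by (auto simp: step_degrees_def)

lemma linear_form_add_smult:
  "linear_form w0 w1 (A + smult r A') (B + smult r B') x =
     linear_form w0 w1 A B x + r * linear_form w0 w1 A' B' x"
  by (simp add: linear_form_def algebra_simps)

lemma linear_form_0 [simp]: "linear_form w0 w1 0 0 x = 0"
  by (simp add: linear_form_def)

lemma has_integral_linear_form_add_smult:
  assumes "((\<lambda>x. x ^ k * linear_form w0 w1 A B x) has_integral I) S"
    and "((\<lambda>x. x ^ k * linear_form w0 w1 A' B' x) has_integral J) S"
  shows "((\<lambda>x. x ^ k * linear_form w0 w1 (A + smult r A') (B + smult r B') x) has_integral I + r * J) S"
  using has_integral_add[OF assms(1) has_integral_mult_right[OF assms(2), of r]]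
  by (simp add: linear_form_add_smult algebra_simps)

text \<open>The step-line indices are nested with one new coefficient per step, and the type I
  functions make the moment matrix triangular; so their existence at all lengths already
  forces the moment map to be injective.\<close>

lemma linear_form_zero_moments:
  assumes ex: "\<And>m. \<exists>A B. type_I_polys w0 w1 (Suc m) A B"
    and "step_degrees n A B"
    and "\<And>k. k < n \<Longrightarrow> ((\<lambda>x. x ^ k * linear_form w0 w1 A B x) has_integral 0) {0<..<1}"
  shows "A = 0 \<and> B = 0"
  using assms(2,3)
proof (induction n arbitrary: A B)
  case 0
  then show ?case
    by (simp add: step_degrees_def poly_eq_iff)
next
  case (Suc n)
  define slot where "slot A B = coeff (if even n then A else B) (n div 2)" for A B :: "real poly"
  have slot: "step_degrees n A B" if "step_degrees (Suc n) A B" "slot A B = 0" for A B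
  proof (cases "even n")
    case True
    then have half: "(Suc n + 1) div 2 = Suc (n div 2)" "(n + 1) div 2 = n div 2" "Suc n div 2 = n div 2"
      by auto
    have "coeff A i = 0" if "i \<ge> n div 2" for i
      using \<open>step_degrees (Suc n) A B\<close> \<open>slot A B = 0\<close> that True
      by (cases "i = n div 2") (simp_all add: step_degrees_def slot_def half)
    then show ?thesis
      using that(1) by (simp add: step_degrees_def half)
  next
    case False
    then have half: "(Suc n + 1) div 2 = Suc (n div 2)" "(n + 1) div 2 = Suc (n div 2)"
      "Suc n div 2 = Suc (n div 2)"
      by (auto elim!: oddE)
    have "coeff B i = 0" if "i \<ge> n div 2" for i
      using \<open>step_degrees (Suc n) A B\<close> \<open>slot A B = 0\<close> that False
      by (cases "i = n div 2") (simp_all add: step_degrees_def slot_def half)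
    then show ?thesis
      using that(1) by (simp add: step_degrees_def half)
  qed
  obtain A' B' where Q: "type_I_polys w0 w1 (Suc n) A' B'"
    using ex by blast
  have Q0: "((\<lambda>x. x ^ k * linear_form w0 w1 A' B' x) has_integral 0) {0<..<1}" if "k < n" for k
    using Q that by (auto simp: type_I_polys_iff)
  have Q1: "((\<lambda>x. x ^ n * linear_form w0 w1 A' B' x) has_integral 1) {0<..<1}"
    and deg: "step_degrees (Suc n) A' B'"
    using Q by (auto simp: type_I_polys_iff)
  \<comment> \<open>Otherwise the type I form would have length n and n vanishing moments, hence be
    zero by induction, against its moment 1.\<close>
  have "slot A' B' \<noteq> 0"
  proof
    assume "slot A' B' = 0"
    then have "A' = 0 \<and> B' = 0"
      by (rule Suc.IH[OF slot[OF deg] Q0])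
    with Q1 have "((\<lambda>x::real. 0::real) has_integral 1) {0<..<1}"
      by simp
    then show False
      by simp
  qed
  define r where "r = - slot A B / slot A' B'"
  have *: "slot (A + smult r A') (B + smult r B') = 0"
    using \<open>slot A' B' \<noteq> 0\<close> by (cases "even n") (simp_all add: slot_def r_def)
  have "A + smult r A' = 0 \<and> B + smult r B' = 0"
  proof (rule Suc.IH)
    show "step_degrees n (A + smult r A') (B + smult r B')"
      by (rule slot[OF step_degrees_add_smult[OF Suc.prems(1) deg] *])
    show "((\<lambda>x. x ^ k * linear_form w0 w1 (A + smult r A') (B + smult r B') x) has_integral 0) {0<..<1}"
      if "k < n" for k
      using has_integral_linear_form_add_smult[OF Suc.prems(2)[of k] Q0[OF that], of r] that by simp
  qed
  note zero = this
  have "((\<lambda>x::real. 0::real) has_integral 0 + r * 1) {0<..<1}"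
    using has_integral_linear_form_add_smult[OF Suc.prems(2)[of n] Q1, of r]
    by (simp only: zero linear_form_0 lessI mult_zero_right)
  then have "r = 0"
    by simp
  with zero show ?case
    by (simp only: smult_0_left add_0_right)
qed

text \<open>Two solutions share their moments of order 0 to n, so
  \<open>linear_form_zero_moments\<close> annihilates their difference, and the definite description
  selects the given pair.\<close>

lemma type_I_function_eqI:
  assumes ex: "\<And>m. \<exists>A B. type_I_polys w0 w1 (Suc m) A B"
    and Q: "type_I_polys w0 w1 (Suc n) A B"
  shows "type_I_function w0 w1 (Suc n) = linear_form w0 w1 A B"
proof -
  have "A' = A \<and> B' = B" if Q': "type_I_polys w0 w1 (Suc n) A' B'" for A' B'
  proof -
    have "A' + smult (-1) A = 0 \<and> B' + smult (-1) B = 0"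
    proof (rule linear_form_zero_moments[OF ex])
      show "step_degrees (Suc n) (A' + smult (-1) A) (B' + smult (-1) B)"
        using Q Q' by (intro step_degrees_add_smult) (auto simp: type_I_polys_iff)
      show "((\<lambda>x. x ^ k * linear_form w0 w1 (A' + smult (-1) A) (B' + smult (-1) B) x)
          has_integral 0) {0<..<1}" if "k < Suc n" for k
      proof (cases "k = n")
        case True
        then show ?thesis
          using has_integral_linear_form_add_smult[of n w0 w1 A' B' 1 _ A B 1 "-1"] Q Q'
          by (simp add: type_I_polys_iff)
      next
        case False
        then show ?thesis
          using has_integral_linear_form_add_smult[of k w0 w1 A' B' 0 _ A B 0 "-1"] Q Q' that
          by (simp add: type_I_polys_iff)
      qed
    qed
    then show ?thesis
      by simp
  qed
  with Q have "(THE (A, B). type_I_polys w0 w1 (Suc n) A B) = (A, B)"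
    by (intro the_equality) blast+
  then show ?thesis
    by (simp add: type_I_function_def)
qed

text \<open>Derivatives depend only on values near the point; this matters because the formulas for
  the weights are compared on (0, 1) only.\<close>

lemma funpow_deriv_cong:
  assumes "open S" "x \<in> S" "\<And>x. x \<in> S \<Longrightarrow> f x = g x"
  shows "(deriv ^^ n) f x = (deriv ^^ n) g x"
  using assms(2,3)
proof (induction n arbitrary: f g x)
  case (Suc n)
  have "deriv f y = deriv g y" if "y \<in> S" for y
  proof (rule deriv_cong_ev)
    show "\<forall>\<^sub>F z in nhds y. f z = g z"
      using eventually_nhds_in_open[OF assms(1) that] by (rule eventually_mono) (rule Suc.prems)
  qed simp
  from Suc.IH[OF Suc.prems(1) this] show ?case
    by (simp only: funpow_Suc_right o_apply)
qed auto

text \<open>Up to sign, n derivatives multiply the t-th moment by this falling factorial: its zeros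
  give the orthogonality conditions, its value n! at t = n the normalisation.\<close>

lemma prod_diff_lessThan_eq_0: "t < n \<Longrightarrow> (\<Prod>j<n. real t - real j) = 0"
  by (intro prod_zero) auto

lemma prod_diff_lessThan_self: "(\<Prod>j<n. real n - real j) = fact n"
  unfolding fact_prod_rev by (simp add: of_nat_diff atLeast0LessThan)

section \<open>The Rodrigues formula\<close>

locale step_line_weights =
  fixes a b c d :: real
  assumes pos: "a > 0" "b > 0"
    and gt: "c > a" "c > b" "d > a" "d > b"
begin

text \<open>Under the Mellin transform (with variable \<open>t\<close>), \<open>f \<mapsto> - (x f)'\<close> is multiplication by \<open>t\<close>, and
  \<open>ladder n k\<close> is proportional to that of the first weight times
  \<open>(\<Prod>l<k. t + u l) / (\<Prod>l<n. t + v l)\<close>.\<close>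

definition ladder :: "nat \<Rightarrow> nat \<Rightarrow> real \<Rightarrow> real" where
  "ladder n k = hyp_weight (a + real (k div 2)) (b + real ((k + 1) div 2))
                  (c + real ((n + 1) div 2)) (d + real (n div 2))"

definition ladder_moment :: "nat \<Rightarrow> nat \<Rightarrow> nat \<Rightarrow> real" where
  "ladder_moment n k t = hyp_moment (a + real (k div 2) + real t) (b + real ((k + 1) div 2) + real t)
                  (c + real ((n + 1) div 2) + real t) (d + real (n div 2) + real t)"

text \<open>The parameter raised from rung k to rung \<open>Suc k\<close>. Starting with b here and
  with c in \<open>v\<close> makes the second weight, with \<open>b + 1\<close> and
  \<open>c + 1\<close>, appear as \<open>ladder 1 1\<close>.\<close>

definition u :: "nat \<Rightarrow> real" where
  "u k = (if even k then b else a) + real (k div 2)"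

definition v :: "nat \<Rightarrow> real" where
  "v n = (if even n then c else d) + real (n div 2)"

lemma u_less_v: "k \<le> n \<Longrightarrow> u k < v n"
  using gt div_le_mono[of k n 2] by (simp add: u_def v_def add_less_le_mono)

section \<open>Derivatives, recurrence and moments along the ladder\<close>

lemma half_sum: "real ((n + 1) div 2) + real (n div 2) = real n"
  by (simp flip: of_nat_add)

lemma DERIV_ladder_u:
  assumes "k < n" "x \<in> {0<..<1}"
  shows "((\<lambda>x. x * ladder n k x) has_real_derivative u k * ladder n k x - ladder n (Suc k) x) (at x)"
proof -
  have "real k + 1 \<le> real n"
    using assms by simp
  then have "c + real ((n + 1) div 2) + (d + real (n div 2)) >
      a + real (k div 2) + (b + real ((k + 1) div 2)) + 1"
    using half_sum[of n] half_sum[of k] gt by linarith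
  note D = DERIV_times_hyp_weight_a[OF this assms(2)] DERIV_times_hyp_weight_b[OF this assms(2)]
  show ?thesis
  proof (cases "even k")
    case True
    then show ?thesis
      using D(2) by (auto simp: ladder_def u_def add_ac elim!: evenE)
  next
    case False
    then show ?thesis
      using D(1) by (auto simp: ladder_def u_def add_ac elim!: oddE)
  qed
qed

lemma DERIV_ladder_v:
  assumes "k \<le> n" "x \<in> {0<..<1}"
  shows "((\<lambda>x. x * ladder (Suc n) k x) has_real_derivative
           v n * ladder (Suc n) k x - ladder n k x) (at x)"
proof -
  have "real k \<le> real n"
    using assms by simp
  then have "c + real ((n + 1) div 2) + (d + real (n div 2)) >
      a + real (k div 2) + (b + real ((k + 1) div 2))"
    using half_sum[of n] half_sum[of k] gt by linarith
  note D = DERIV_times_hyp_weight_c[OF this assms(2)] DERIV_times_hyp_weight_d[OF this assms(2)]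
  show ?thesis
  proof (cases "even n")
    case True
    then show ?thesis
      using D(1) by (auto simp: ladder_def v_def add_ac elim!: evenE)
  next
    case False
    then show ?thesis
      using D(2) by (auto simp: ladder_def v_def add_ac elim!: oddE)
  qed
qed

text \<open>Both derivative rules apply to \<open>x * ladder (Suc n) k x\<close>, and the results
  are compared. On the Mellin side, t + v n = (v n - u k) + (t + u k).\<close>

lemma ladder_rec:
  assumes "k \<le> n" "x \<in> {0<..<1}"
  shows "ladder n k x = (v n - u k) * ladder (Suc n) k x + ladder (Suc n) (Suc k) x"
  using DERIV_unique[OF DERIV_ladder_u[of k "Suc n" x] DERIV_ladder_v[of k n x]] assms
  by (simp add: algebra_simps)

lemma has_integral_ladder:
  assumes "k \<le> n"
  shows "((\<lambda>x. x ^ t * ladder n k x) has_integral ladder_moment n k t) {0<..<1}"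
proof -
  \<comment> \<open>For odd n and k = n the shift of b exceeds that of d by one; this is where the
    moment formula is needed under \<open>d + 1 > b\<close> rather than
    \<open>d > b\<close>.\<close>
  have le: "(k + 1) div 2 \<le> (n + 1) div 2" "(k + 1) div 2 \<le> n div 2 + 1" "k \<le> n"
    using assms by auto
  then have le': "real ((k + 1) div 2) \<le> real ((n + 1) div 2)" "real ((k + 1) div 2) \<le> real (n div 2) + 1"
      "real k \<le> real n"
    by linarith+
  have "(hyp_weight (a + real (k div 2) + real t) (b + real ((k + 1) div 2) + real t)
     (c + real ((n + 1) div 2) + real t) (d + real (n div 2) + real t)
     has_integral ladder_moment n k t) {0<..<1}"
    unfolding ladder_moment_def
    using pos gt le' half_sum[of n] half_sum[of k] by (intro has_integral_hyp_weight; linarith)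
  then show ?thesis
    by (rule has_integral_eq[rotated]) (simp add: ladder_def power_mult_hyp_weight)
qed

lemma ladder_moment_Suc: "ladder_moment n (Suc k) t = (u k + real t) * ladder_moment n k t"
proof -
  let ?a = "a + real (k div 2) + real t" and ?b = "b + real ((k + 1) div 2) + real t"
  have "?a > 0" "?b > 0" "c + real ((n + 1) div 2) + real t > 0" "d + real (n div 2) + real t > 0"
    using pos gt by linarith+
  note raise = hyp_moment_raise(1,2)[OF this]
  show ?thesis
  proof (cases "even k")
    case True
    then have "Suc k div 2 = k div 2" "(Suc k + 1) div 2 = k div 2 + 1"
      by auto
    then show ?thesis
      using raise(2) by (simp add: ladder_moment_def u_def True algebra_simps)
  next
    case False
    then have "Suc k div 2 = k div 2 + 1" "(Suc k + 1) div 2 = k div 2 + 1"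
      by (auto elim!: oddE)
    then show ?thesis
      using raise(1) by (simp add: ladder_moment_def u_def False algebra_simps)
  qed
qed

section \<open>Linear forms with step-line degrees\<close>

definition spanned :: "nat \<Rightarrow> (real \<Rightarrow> real) \<Rightarrow> bool" where
  "spanned n f \<longleftrightarrow> (\<exists>A B. step_degrees n A B \<and> (\<forall>x\<in>{0<..<1}. f x =
     linear_form (W_weight a b c d) (W_weight a (b + 1) (c + 1) d) A B x))"

lemma spanned_add_mult:
  "spanned n f \<Longrightarrow> spanned n g \<Longrightarrow> spanned n (\<lambda>x. f x + r * g x)"
  unfolding spanned_def linear_form_add_smult
proof (elim exE conjE)
  fix A B A' B'
  let ?L = "linear_form (W_weight a b c d) (W_weight a (b + 1) (c + 1) d)"
  assume "step_degrees n A B" "step_degrees n A' B'"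
    "\<forall>x\<in>{0<..<1}. f x = ?L A B x" "\<forall>x\<in>{0<..<1}. g x = ?L A' B' x"
  then show "\<exists>A B. step_degrees n A B \<and> (\<forall>x\<in>{0<..<1}. f x + r * g x = ?L A B x)"
    by (intro exI[of _ "A + smult r A'"] exI[of _ "B + smult r B'"])
      (simp add: step_degrees_add_smult linear_form_add_smult)
qed

lemma spanned_0: "spanned n (\<lambda>x. 0)"
  unfolding spanned_def by (intro exI[of _ 0]) (simp add: step_degrees_def)

lemma spanned_sum: "(\<And>k. k \<in> K \<Longrightarrow> spanned n (f k)) \<Longrightarrow> spanned n (\<lambda>x. \<Sum>k\<in>K. r k * f k x)"
proof (induction K rule: infinite_finite_induct)
  case (insert k K)
  then have "spanned n (\<lambda>x. (\<Sum>k\<in>K. r k * f k x) + r k * f k x)"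
    by (intro spanned_add_mult) auto
  then show ?case
    using insert by (simp add: add.commute)
qed (simp_all add: spanned_0)

lemma spanned_Suc: "spanned n f \<Longrightarrow> spanned (Suc n) f"
  unfolding spanned_def by (blast intro: step_degrees_Suc)

lemma spanned_cong:
  assumes "spanned n f" "\<And>x. x \<in> {0<..<1} \<Longrightarrow> f x = g x"
  shows "spanned n g"
proof -
  obtain A B where "step_degrees n A B"
    "\<forall>x\<in>{0<..<1}. f x = linear_form (W_weight a b c d) (W_weight a (b + 1) (c + 1) d) A B x"
    using assms(1) unfolding spanned_def by blast
  then show ?thesis
    unfolding spanned_def using assms(2) by (intro exI[of _ A] exI[of _ B]) simp
qed

text \<open>\<open>ladder n n\<close> is x^(n div 2) times the unnormalised first weight for even n
  and second weight for odd n, so one monomial suffices; its coefficient undoes the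
  normalisation.\<close>

lemma spanned_ladder_diag: "spanned (Suc n) (ladder n n)"
proof (cases "even n")
  case True
  then obtain m where n: "n = 2 * m" ..
  have "hyp_moment a b c d > 0"
    using pos gt by (intro hyp_moment_pos) auto
  then have "step_degrees (Suc n) (monom (hyp_moment a b c d) m) 0 \<and> (\<forall>x\<in>{0<..<1}. ladder n n x =
     linear_form (W_weight a b c d) (W_weight a (b + 1) (c + 1) d) (monom (hyp_moment a b c d) m) 0 x)"
    by (auto simp: n step_degrees_def ladder_def linear_form_def poly_monom W_weight_eq_hyp_weight
        power_mult_hyp_weight)
  then show ?thesis
    unfolding spanned_def by blast
next
  case False
  then obtain m where n: "n = 2 * m + 1" ..
  let ?M = "hyp_moment a (b + 1) (c + 1) d"
  have "?M > 0"
    using pos gt by (intro hyp_moment_pos) auto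
  then have "step_degrees (Suc n) 0 (monom ?M m) \<and> (\<forall>x\<in>{0<..<1}. ladder n n x =
     linear_form (W_weight a b c d) (W_weight a (b + 1) (c + 1) d) 0 (monom ?M m) x)"
    by (auto simp: n step_degrees_def ladder_def linear_form_def poly_monom W_weight_eq_hyp_weight
        power_mult_hyp_weight add_ac)
  then show ?thesis
    unfolding spanned_def by blast
qed

text \<open>For each n, descend from the diagonal: \<open>ladder_rec\<close>, solved for
  \<open>ladder (Suc n) k\<close>, expresses it by \<open>ladder n k\<close> and the rung above. The
  divisor is nonzero by \<open>u_less_v\<close>.\<close>

lemma spanned_ladder: "k \<le> n \<Longrightarrow> spanned (Suc n) (ladder n k)"
proof (induction n arbitrary: k)
  case 0
  then show ?case
    using spanned_ladder_diag[of 0] by simp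
next
  case (Suc n)
  from Suc.prems show ?case
  proof (induction k rule: inc_induct)
    case base
    show ?case
      by (rule spanned_ladder_diag)
  next
    case (step k)
    then have k: "k \<le> n"
      by simp
    let ?r = "1 / (v n - u k)"
    have "spanned (Suc (Suc n)) (\<lambda>x. 0 + ?r * (ladder n k x + (-1) * ladder (Suc n) (Suc k) x))"
      using k step.IH by (intro spanned_add_mult spanned_0 spanned_Suc[OF Suc.IH])
    then show ?case
    proof (rule spanned_cong)
      fix x :: real assume "x \<in> {0<..<1}"
      then show "0 + ?r * (ladder n k x + (-1) * ladder (Suc n) (Suc k) x) = ladder (Suc n) k x"
        using ladder_rec[OF k] u_less_v[OF k] by simp
    qed
  qed
qed

text \<open>Since \<open>(x ^ Suc r * f)' = x ^ r * (r * f + (x * f)')\<close>, each derivative climbs one rung.\<close>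

lemma funpow_deriv_ladder:
  assumes "r \<le> n"
  shows "\<exists>\<beta>. (\<forall>x\<in>{0<..<1}. (deriv ^^ r) (\<lambda>x. x ^ r * (\<Sum>k\<le>n - r. \<alpha> k * ladder n k x)) x
               = (\<Sum>k\<le>n. \<beta> k * ladder n k x)) \<and>
             (\<forall>t. (\<Sum>k\<le>n. \<beta> k * ladder_moment n k t)
               = (-1) ^ r * (\<Prod>j<r. real t - real j) * (\<Sum>k\<le>n - r. \<alpha> k * ladder_moment n k t))"
  using assms
proof (induction r arbitrary: \<alpha>)
  case 0
  show ?case
    by (intro exI[of _ \<alpha>]) simp
next
  case (Suc r)
  define m where "m = n - Suc r"
  have m: "n - r = Suc m" "m < n"
    using Suc.prems by (auto simp: m_def)
  \<comment> \<open>Terms collected by rung: rung k receives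
    \<open>(real r + u k) * \<alpha> k\<close> from itself and \<open>- \<alpha> (k - 1)\<close>
    from the rung below; the new top rung \<open>Suc m\<close> receives only the latter.\<close>
  define \<alpha>' where "\<alpha>' k = (if k \<le> m then (real r + u k) * \<alpha> k else 0) - (if k = 0 then 0 else \<alpha> (k - 1))" for k
  have \<alpha>': "(\<Sum>k\<le>Suc m. \<alpha>' k * Z k) = (\<Sum>k\<le>m. (real r + u k) * \<alpha> k * Z k - \<alpha> k * Z (Suc k))" for Z
  proof -
    have "(\<Sum>k\<le>Suc m. \<alpha>' k * Z k) = (\<Sum>k\<le>Suc m. (if k \<le> m then (real r + u k) * \<alpha> k else 0) * Z k)
        - (\<Sum>k\<le>Suc m. (if k = 0 then 0 else \<alpha> (k - 1)) * Z k)"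
      by (simp add: \<alpha>'_def left_diff_distrib sum_subtractf del: sum.atMost_Suc)
    also have "(\<Sum>k\<le>Suc m. (if k = 0 then 0 else \<alpha> (k - 1)) * Z k) = (\<Sum>k\<le>m. \<alpha> k * Z (Suc k))"
      by (subst sum.atMost_Suc_shift) simp
    finally show ?thesis
      by (simp add: sum_subtractf)
  qed
  obtain \<beta> where \<beta>: "\<And>x. x \<in> {0<..<1} \<Longrightarrow>
        (deriv ^^ r) (\<lambda>x. x ^ r * (\<Sum>k\<le>n - r. \<alpha>' k * ladder n k x)) x = (\<Sum>k\<le>n. \<beta> k * ladder n k x)"
      "\<And>t. (\<Sum>k\<le>n. \<beta> k * ladder_moment n k t)
        = (-1) ^ r * (\<Prod>j<r. real t - real j) * (\<Sum>k\<le>n - r. \<alpha>' k * ladder_moment n k t)"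
    using Suc.IH[of \<alpha>'] Suc.prems by auto
  have "deriv (\<lambda>x. x ^ Suc r * (\<Sum>k\<le>m. \<alpha> k * ladder n k x)) x
      = x ^ r * (\<Sum>k\<le>n - r. \<alpha>' k * ladder n k x)" if x: "x \<in> {0<..<1}" for x
  proof (rule DERIV_imp_deriv)
    let ?S = "\<Sum>k\<le>m. \<alpha> k * (x * ladder n k x)"
    let ?S' = "\<Sum>k\<le>m. \<alpha> k * (u k * ladder n k x - ladder n (Suc k) x)"
    have "((\<lambda>x. x ^ r * (\<Sum>k\<le>m. \<alpha> k * (x * ladder n k x))) has_real_derivative
        (real r * x ^ (r - 1)) * ?S + ?S' * x ^ r) (at x)"
      using x m by (intro DERIV_mult DERIV_sum DERIV_cmult DERIV_ladder_u) (auto intro!: derivative_eq_intros)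
    moreover have "x ^ r * (\<Sum>k\<le>m. \<alpha> k * (x * ladder n k x)) = x ^ Suc r * (\<Sum>k\<le>m. \<alpha> k * ladder n k x)" for x
      by (simp add: sum_distrib_left mult_ac)
    moreover have "real r * x ^ (r - 1) * ?S = x ^ r * (\<Sum>k\<le>m. real r * \<alpha> k * ladder n k x)"
      by (cases r) (simp_all add: sum_distrib_left mult_ac)
    moreover have "(\<Sum>k\<le>m. real r * \<alpha> k * ladder n k x) + ?S' = (\<Sum>k\<le>n - r. \<alpha>' k * ladder n k x)"
      unfolding m \<alpha>' by (simp add: algebra_simps flip: sum.distrib)
    ultimately show "((\<lambda>x. x ^ Suc r * (\<Sum>k\<le>m. \<alpha> k * ladder n k x)) has_real_derivative
        x ^ r * (\<Sum>k\<le>n - r. \<alpha>' k * ladder n k x)) (at x)"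
      by (simp add: distrib_left mult.commute[of ?S'] flip: \<open>_ + ?S' = _\<close>)
  qed
  then have "(deriv ^^ Suc r) (\<lambda>x. x ^ Suc r * (\<Sum>k\<le>n - Suc r. \<alpha> k * ladder n k x)) x
      = (\<Sum>k\<le>n. \<beta> k * ladder n k x)" if "x \<in> {0<..<1}" for x
    unfolding funpow_Suc_right o_apply m_def[symmetric] \<beta>(1)[OF that, symmetric]
    using that by (intro funpow_deriv_cong[of "{0<..<1}"]) auto
  moreover have "(\<Sum>k\<le>n. \<beta> k * ladder_moment n k t) = (-1) ^ Suc r * (\<Prod>j<Suc r. real t - real j)
      * (\<Sum>k\<le>n - Suc r. \<alpha> k * ladder_moment n k t)" for t
  proof -
    \<comment> \<open>In the moments u k cancels: (r + u k) - (u k + t) = r - t, the next factor of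
      the falling factorial with its sign reversed.\<close>
    have "(\<Sum>k\<le>n - r. \<alpha>' k * ladder_moment n k t) =
        (\<Sum>k\<le>m. (real r - real t) * (\<alpha> k * ladder_moment n k t))"
      unfolding m \<alpha>' using m by (intro sum.cong refl) (simp add: ladder_moment_Suc algebra_simps)
    also have "\<dots> = (real r - real t) * (\<Sum>k\<le>m. \<alpha> k * ladder_moment n k t)"
      by (simp add: sum_distrib_left)
    finally show ?thesis
      unfolding \<beta>(2) m_def[symmetric] by (simp only: prod.lessThan_Suc power_Suc) (simp add: algebra_simps)
  qed
  ultimately show ?case
    by blast
qed

text \<open>The n-th derivative is a combination of the rungs, which gives the degrees, and its
  moments carry the falling factorial, which gives the type I conditions.\<close>

lemma Rodrigues_type_I:
  "\<exists>A B. type_I_polys (W_weight a b c d) (W_weight a (b + 1) (c + 1) d) (Suc n) A B \<and>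
     (\<forall>x\<in>{0<..<1}. linear_form (W_weight a b c d) (W_weight a (b + 1) (c + 1) d) A B x =
       (- 1) ^ n / fact n *
      (deriv ^^ n)
        (W_weight (a + real n) (b + real n)
           (c + real ((n + 1) div 2) + real n) (d + real (n div 2) + real n)) x)"
proof -
  \<comment> \<open>The \<open>hyp_moment\<close> of the shifted parameters, so that dividing by it
    turns \<open>x ^ n * ladder n 0 x\<close> into the \<open>W_weight\<close> to be
    differentiated.\<close>
  define M where "M = ladder_moment n 0 n"
  have M: "M \<noteq> 0"
    using hyp_moment_pos[of "a + real n" "b + real n" "c + real ((n + 1) div 2) + real n"
        "d + real (n div 2) + real n"] pos gt
    by (simp add: M_def ladder_moment_def)
  let ?W = "W_weight (a + real n) (b + real n)
           (c + real ((n + 1) div 2) + real n) (d + real (n div 2) + real n)"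
  let ?L = "linear_form (W_weight a b c d) (W_weight a (b + 1) (c + 1) d)"
  have W: "?W x = x ^ n * (\<Sum>k\<le>n - n. 1 / M * ladder n k x)" if "x \<in> {0<..<1}" for x
    using that by (simp add: W_weight_eq_hyp_weight M_def ladder_def ladder_moment_def power_mult_hyp_weight)
  obtain \<beta> where \<beta>: "\<And>x. x \<in> {0<..<1} \<Longrightarrow>
        (deriv ^^ n) (\<lambda>x. x ^ n * (\<Sum>k\<le>n - n. 1 / M * ladder n k x)) x = (\<Sum>k\<le>n. \<beta> k * ladder n k x)"
      "\<And>t. (\<Sum>k\<le>n. \<beta> k * ladder_moment n k t)
        = (-1) ^ n * (\<Prod>j<n. real t - real j) * (\<Sum>k\<le>n - n. 1 / M * ladder_moment n k t)"
    using funpow_deriv_ladder[of n n "\<lambda>_. 1 / M"] by auto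
  define \<gamma> where "\<gamma> k = (-1) ^ n / fact n * \<beta> k" for k
  have eq: "(-1) ^ n / fact n * (deriv ^^ n) ?W x = (\<Sum>k\<le>n. \<gamma> k * ladder n k x)"
    if "x \<in> {0<..<1}" for x
  proof -
    have "(deriv ^^ n) ?W x = (\<Sum>k\<le>n. \<beta> k * ladder n k x)"
      unfolding \<beta>(1)[OF that, symmetric]
      using that W by (intro funpow_deriv_cong[of "{0<..<1}"]) auto
    then show ?thesis
      by (simp add: \<gamma>_def sum_distrib_left mult_ac)
  qed
  have "spanned (Suc n) (\<lambda>x. \<Sum>k\<le>n. \<gamma> k * ladder n k x)"
    by (intro spanned_sum spanned_ladder) auto
  then obtain A B where AB: "step_degrees (Suc n) A B"
      "\<And>x. x \<in> {0<..<1} \<Longrightarrow> (\<Sum>k\<le>n. \<gamma> k * ladder n k x) = ?L A B x"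
    unfolding spanned_def by blast
  \<comment> \<open>The two signs (-1)^n cancel; the product is 0 for t < n, and at t = n both
    quotients are 1.\<close>
  have int: "((\<lambda>x. x ^ t * ?L A B x) has_integral
      (\<Prod>j<n. real t - real j) / fact n * (ladder_moment n 0 t / M)) {0<..<1}" for t
  proof -
    have "((\<lambda>x. \<Sum>k\<le>n. \<gamma> k * (x ^ t * ladder n k x)) has_integral
        (\<Sum>k\<le>n. \<gamma> k * ladder_moment n k t)) {0<..<1}"
      by (intro has_integral_sum has_integral_mult_right has_integral_ladder) auto
    also have "(\<Sum>k\<le>n. \<gamma> k * ladder_moment n k t) = (-1) ^ n / fact n * (\<Sum>k\<le>n. \<beta> k * ladder_moment n k t)"
      by (simp add: \<gamma>_def sum_distrib_left mult_ac)
    also have "\<dots> = (\<Prod>j<n. real t - real j) / fact n * (ladder_moment n 0 t / M)"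
      unfolding \<beta>(2) by (simp flip: power_add mult_2)
    finally show ?thesis
      by (rule has_integral_eq[rotated]) (simp add: sum_distrib_left mult_ac flip: AB(2))
  qed
  have "type_I_polys (W_weight a b c d) (W_weight a (b + 1) (c + 1) d) (Suc n) A B"
    unfolding type_I_polys_iff
  proof (intro conjI allI impI)
    show "((\<lambda>x. x ^ k * ?L A B x) has_integral 0) {0<..<1}" if "k + 2 \<le> Suc n" for k
      using int[of k] that by (simp add: prod_diff_lessThan_eq_0)
    show "((\<lambda>x. x ^ (Suc n - 1) * ?L A B x) has_integral 1) {0<..<1}"
      using int[of n] M by (simp add: prod_diff_lessThan_self M_def)
  qed (rule AB)
  with eq AB(2) show ?thesis
    by (intro exI[of _ A] exI[of _ B]) simp
qed

end

theorem theorem2p5: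
  fixes a b c d x :: real and n :: nat
  assumes "a > 0" and "b > 0" and "c > 0" and "d > 0"
    and "min c d > max a b"
    and "x \<in> {0<..<1}"
  shows "Q_type_I (n + 1) a b c d x =
    (- 1) ^ n / fact n *
      (deriv ^^ n)
        (W_weight (a + real n) (b + real n)
           (c + real ((n + 1) div 2) + real n) (d + real (n div 2) + real n)) x"
proof -
  interpret step_line_weights a b c d
    using assms by unfold_locales auto
  obtain A B where AB: "type_I_polys (W_weight a b c d) (W_weight a (b + 1) (c + 1) d) (Suc n) A B"
      "\<And>x. x \<in> {0<..<1} \<Longrightarrow> linear_form (W_weight a b c d) (W_weight a (b + 1) (c + 1) d) A B x =
       (- 1) ^ n / fact n * (deriv ^^ n)
        (W_weight (a + real n) (b + real n)
           (c + real ((n + 1) div 2) + real n) (d + real (n div 2) + real n)) x"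
    using Rodrigues_type_I[of n] by blast
  \<comment> \<open>The uniqueness argument consumes existence at every length, not only at
    \<open>Suc n\<close>.\<close>
  have "Q_type_I (Suc n) a b c d = linear_form (W_weight a b c d) (W_weight a (b + 1) (c + 1) d) A B"
    unfolding Q_type_I_def by (rule type_I_function_eqI[OF _ AB(1)]) (use Rodrigues_type_I in blast)
  with AB(2)[OF assms(6)] show ?thesis
    by simp
qed

end
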